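(* Let $p>3$ be a prime. (i) Let $A,B\in\mathbb{Z}$ with $p\nmid B$ and $\left(\frac{A^2-4B}{p}\right)=1$. Then, for any $n\in\{0,1,2,\ldots\}$ we have $$\sum_{k=0}^{p-1}(1+B^{-k})u_k(A,B)H_k^n\equiv 0\pmod p$$ and $$\sum_{k=0}^{p-1}(1-B^{-k})v_k(A,B)H_k^n\equiv 0\pmod p.$$ (ii) We have $$\sum_{k=0}^{p-1}(-1)^k\left(\frac k3\right)H_k\equiv 0\pmod p$$ and $$\sum_{k=0}^{p-1}\left(\frac k3\right)H_k\equiv\frac{\left(\frac p3\right)-1}{4}\,q_p(3)\pmod p,$$ where $q_p(3)=(3^{p-1}-1)/p$. Also, $$\sum_{k=0}^{p-1}(-1)^k\left(\frac k3\right)kH_k\equiv\frac{1-\left(\frac p3\right)}{2}\pmod p$$ and $$\sum_{k=0}^{p-1}(1+2^{-k})u_k(2,2)H_k\equiv 0\pmod p.$$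
   Context: For $n\in\{0,1,2,\ldots\}$, the harmonic number is $H_n=\sum_{0<j\le n}1/j$ (so $H_0=0$); $H_k^n$ denotes the $n$-th power $(H_k)^n$. For $A,B\in\mathbb{Z}$ the Lucas sequences $u_n=u_n(A,B)$ and $v_n=v_n(A,B)$ ($n\ge 0$) are defined by $u_0=0$, $u_1=1$, $u_{n+1}=Au_n-Bu_{n-1}$ for $n\ge1$, and $v_0=2$, $v_1=A$, $v_{n+1}=Av_n-Bv_{n-1}$ for $n\ge1$. The symbol $\left(\frac{\cdot}{\cdot}\right)$ is the Jacobi (Legendre) symbol; in particular $\left(\frac k3\right)$ is $0,1,-1$ according as $k\equiv 0,1,2\pmod 3$. A congruence $x\equiv y\pmod{p}$ between rational numbers means that $x-y\in p\,\mathbb{Z}_{(p)}$, where $\mathbb{Z}_{(p)}$ is the ring of rational numbers whose denominator (in lowest terms) is prime to $p$. *)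

theory Defs
  imports Complex_Main "HOL-Number_Theory.Number_Theory" "HOL-Analysis.Harmonic_Numbers"
begin

text \<open>
  The harmonic numbers of the library (\<open>harm\<close>) live in real normed fields, which exclude the type
  \<^typ>\<open>rat\<close> of the congruences below.
\<close>

definition harmonic :: "nat \<Rightarrow> rat" where
  "harmonic n = (\<Sum>j\<in>{0<..n}. 1 / of_nat j)"

lemma of_rat_harmonic: "(of_rat (harmonic n) :: real) = harm n"
proof -
  have "{0<..n} = {1..n}" by auto
  thus ?thesis
    by (simp add: harmonic_def harm_def of_rat_sum of_rat_divide field_simps)
qed

fun lucas_u :: "int \<Rightarrow> int \<Rightarrow> nat \<Rightarrow> int" where
  "lucas_u A B 0 = 0"
| "lucas_u A B (Suc 0) = 1"
| "lucas_u A B (Suc (Suc n)) = A * lucas_u A B (Suc n) - B * lucas_u A B n"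

fun lucas_v :: "int \<Rightarrow> int \<Rightarrow> nat \<Rightarrow> int" where
  "lucas_v A B 0 = 2"
| "lucas_v A B (Suc 0) = A"
| "lucas_v A B (Suc (Suc n)) = A * lucas_v A B (Suc n) - B * lucas_v A B n"

text \<open>
  For prime \<open>p\<close>, \<open>localized_ints p\<close> is the localization of the integers at \<open>p\<close>;
  \<^const>\<open>quotient_of\<close> yields numerator and denominator in lowest terms.
\<close>

definition localized_ints :: "nat \<Rightarrow> rat set" where
  "localized_ints p = {r. coprime (snd (quotient_of r)) (int p)}"

definition rat_cong :: "rat \<Rightarrow> rat \<Rightarrow> nat \<Rightarrow> bool"
    (\<open>(\<open>indent=1 notation=\<open>mixfix rat_cong\<close>\<close>[_ \<equiv> _] '(' rmod _'))\<close>) where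
  "[x \<equiv> y] (rmod p) \<longleftrightarrow> (\<exists>z\<in>localized_ints p. x - y = of_nat p * z)"

definition fermat_quotient :: "nat \<Rightarrow> int \<Rightarrow> rat" where
  "fermat_quotient p a = (of_int a ^ (p - 1) - 1) / of_nat p"

end

theory Submission
  imports Defs
begin

text \<open>
  Everything rests on the symmetry \<open>1/(p - j) \<equiv> - 1/j\<close> modulo \<open>p\<close>, which gives \<open>H\<^bsub>p-1\<^esub> \<equiv> 0\<close>
  and \<open>H\<^bsub>p-1-k\<^esub> \<equiv> H\<^sub>k\<close>.

  For Lucas sequences whose discriminant is a nonzero square modulo \<open>p\<close>, the characteristic roots
  \<open>a, b\<close> exist modulo \<open>p\<close>. Since \<open>a\<^bsup>p-1\<^esup> \<equiv> b\<^bsup>p-1\<^esup> \<equiv> 1\<close>, the factor \<open>B\<^bsup>-k\<^esup> \<equiv> (a b)\<^bsup>-k\<^esup>\<close>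
  turns \<open>u\<^sub>k\<close> into \<open>- u\<^bsub>p-1-k\<^esub>\<close> and \<open>v\<^sub>k\<close> into \<open>v\<^bsub>p-1-k\<^esub>\<close>
  (\<open>lucas_reflect_cong\<close>). Hence \<open>k \<mapsto> p - 1 - k\<close> maps each sum without the factor to, up to sign,
  the sum with it, and the two cancel, for every power of \<open>H\<^sub>k\<close>.

  The remaining congruences include primes for which the roots lie only in a quadratic extension, so a
  different method is used. Its idea is that \<open>\<Sum> x\<^sup>k H\<^sub>k\<close> becomes \<open>\<Sum> x\<^sup>j/j\<close> by summation by parts
  (up to the factor \<open>1/(1 - x)\<close>), and that \<open>1/j \<equiv> - (-1)\<^sup>j (p choose j) / p\<close> turns the latter into
  \<open>- ((1 - x)\<^sup>p - 1 + x\<^sup>p) / p\<close>. For the roots of unity \<open>x\<close> of order 3 and 6, and for \<open>1 + i\<close>,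
  \<open>(1 + i)/2\<close> and their conjugates, the square of \<open>1 - x\<close> is a rational number times a power of \<open>x\<close>, so the
  power \<open>(1 - x)\<^sup>p\<close> is explicit.
  To stay inside the rational numbers, the powers \<open>x\<^sup>j\<close> are replaced by rational solutions \<open>w\<close> of the
  recurrence of \<open>x\<close>, and the relation \<open>(1 - x)\<^sup>2 = c x\<^sup>r\<close> by
  \<open>w\<^sub>i - 2 w\<^bsub>i+1\<^esub> + w\<^bsub>i+2\<^esub> = c w\<^bsub>i+r\<^esub>\<close>; the result is \<open>harmonic_weighted_sum_cong\<close>.
  The nonzero right-hand sides come from the boundary terms: the Fermat quotient from
  \<open>((-3)\<^bsup>(p-1)/2\<^esup> + 1)/p\<close>, whose integrality at \<open>p\<close> is itself a consequence of the binomial formula.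
\<close>

section \<open>Lucas sequences modulo a prime\<close>

lemma lucas_u_roots_cong:
  assumes "[a + b = A] (mod m)" "[a * b = B] (mod m)"
  shows "[(a - b) * lucas_u A B k = a ^ k - b ^ k] (mod m)"
  using assms
proof (induction A B k rule: lucas_u.induct)
  case (3 A B n)
  have "(a - b) * lucas_u A B (Suc (Suc n))
      = A * ((a - b) * lucas_u A B (Suc n)) - B * ((a - b) * lucas_u A B n)"
    by (simp add: algebra_simps)
  also have "[\<dots> = (a + b) * (a ^ Suc n - b ^ Suc n) - (a * b) * (a ^ n - b ^ n)] (mod m)"
    using 3 by (intro cong_diff cong_mult) (auto intro: cong_sym)
  also have "(a + b) * (a ^ Suc n - b ^ Suc n) - (a * b) * (a ^ n - b ^ n)
      = a ^ Suc (Suc n) - b ^ Suc (Suc n)"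
    by (simp add: algebra_simps)
  finally show ?case .
qed auto

lemma lucas_v_roots_cong:
  assumes "[a + b = A] (mod m)" "[a * b = B] (mod m)"
  shows "[lucas_v A B k = a ^ k + b ^ k] (mod m)"
  using assms
proof (induction A B k rule: lucas_v.induct)
  case (3 A B n)
  have "[lucas_v A B (Suc (Suc n)) = (a + b) * (a ^ Suc n + b ^ Suc n) - (a * b) * (a ^ n + b ^ n)] (mod m)"
    unfolding lucas_v.simps using 3 by (intro cong_diff cong_mult) (auto intro: cong_sym)
  also have "(a + b) * (a ^ Suc n + b ^ Suc n) - (a * b) * (a ^ n + b ^ n)
      = a ^ Suc (Suc n) + b ^ Suc (Suc n)"
    by (simp add: algebra_simps)
  finally show ?case .
qed (auto intro: cong_sym)

text \<open>
  The quadratic formula modulo \<open>p\<close>: if \<open>s\<close> is a square root of the discriminant, then one of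
  \<open>A + s\<close> and \<open>A + s + p\<close> is even and can be halved in the integers.
\<close>

lemma char_roots_exist:
  fixes A B :: int and p :: nat
  assumes "prime p" "p > 2" "Legendre (A ^ 2 - 4 * B) (int p) = 1"
  obtains a b where "[a + b = A] (mod int p)" "[a * b = B] (mod int p)" "\<not> int p dvd a - b"
proof -
  have "\<not> [A ^ 2 - 4 * B = 0] (mod int p)" "QuadRes (int p) (A ^ 2 - 4 * B)"
    using assms(3) by (auto simp: Legendre_def split: if_splits)
  then obtain s where s: "[s ^ 2 = A ^ 2 - 4 * B] (mod int p)" "\<not> [s ^ 2 = 0] (mod int p)"
    unfolding QuadRes_def by (metis cong_trans cong_sym)
  have "odd p"
    using assms prime_odd_nat by blast
  then obtain h where p: "p = 2 * h + 1"
    by (elim oddE)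
  define t where "t = (if even (A + s) then s else s + int p)"
  have "even (A + t)"
    using \<open>odd p\<close> by (auto simp: t_def)
  then obtain a where a: "A + t = 2 * a" ..
  have ts: "[t = s] (mod int p)"
    by (auto simp: t_def cong_iff_dvd_diff)
  have "[2 ^ 2 * (a * (A - a)) = A ^ 2 - t ^ 2] (mod int p)"
  proof -
    have t: "t = 2 * a - A" using a by simp
    show ?thesis unfolding t by (simp add: power2_eq_square algebra_simps)
  qed
  also have "[A ^ 2 - t ^ 2 = A ^ 2 - s ^ 2] (mod int p)"
    by (intro cong_diff cong_pow ts cong_refl)
  also have "[A ^ 2 - s ^ 2 = A ^ 2 - (A ^ 2 - 4 * B)] (mod int p)"
    by (intro cong_diff s cong_refl)
  finally have "[4 * (a * (A - a)) = 4 * B] (mod int p)"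
    by simp
  moreover have "coprime (2 ^ 2) (int p)"
    using \<open>odd p\<close> by (subst coprime_power_left_iff) simp
  ultimately have ab: "[a * (A - a) = B] (mod int p)"
    by (simp add: cong_mult_lcancel)
  have "a - (A - a) = t"
    using a by simp
  moreover have "\<not> int p dvd t"
    using s(2) ts by (metis cong_0_iff cong_dvd_iff dvd_power_le dvd_trans dvd_power pos2)
  ultimately show thesis
    using that[of a "A - a"] ab by simp
qed

section \<open>Alternating binomial sums\<close>

lemma alternating_binomial_sum_Suc:
  fixes w :: "nat \<Rightarrow> 'a :: comm_ring_1"
  shows "(\<Sum>j\<le>Suc n. (- 1) ^ j * of_nat (Suc n choose j) * w j)
    = (\<Sum>j\<le>n. (- 1) ^ j * of_nat (n choose j) * (w j - w (Suc j)))"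
proof -
  have "(\<Sum>j\<le>Suc n. (- 1) ^ j * of_nat (Suc n choose j) * w j)
      = w 0 - (\<Sum>j\<le>n. (- 1) ^ j * of_nat (n choose j) * w (Suc j))
        - (\<Sum>j\<le>n. (- 1) ^ j * of_nat (n choose Suc j) * w (Suc j))"
    unfolding sum.atMost_Suc_shift
    by (simp add: algebra_simps sum.distrib sum_negf sum_subtractf)
  moreover have "(\<Sum>j\<le>n. (- 1) ^ j * of_nat (n choose j) * w j)
      = (\<Sum>j\<le>Suc n. (- 1) ^ j * of_nat (n choose j) * w j)"
    by (simp add: binomial_eq_0)
  then have "(\<Sum>j\<le>n. (- 1) ^ j * of_nat (n choose j) * w j)
      = w 0 - (\<Sum>j\<le>n. (- 1) ^ j * of_nat (n choose Suc j) * w (Suc j))"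
    unfolding sum.atMost_Suc_shift by (simp add: sum_negf)
  ultimately show ?thesis
    by (simp only: right_diff_distrib sum_subtractf diff_diff_eq add.commute)
qed

text \<open>
  With the shift operator \<open>E\<close>, the left-hand side is \<open>(1 - E)\<^bsup>2m+1\<^esup> w\<close> at \<open>i\<close>, and the assumption
  says \<open>(1 - E)\<^sup>2 w = c E\<^sup>r w\<close>.
\<close>

lemma alternating_binomial_sum:
  fixes w :: "nat \<Rightarrow> 'a :: comm_ring_1"
  assumes "\<And>i. w i - 2 * w (Suc i) + w (Suc (Suc i)) = c * w (i + r)"
  shows "(\<Sum>j\<le>2 * m + 1. (- 1) ^ j * of_nat ((2 * m + 1) choose j) * w (i + j))
    = c ^ m * (w (i + r * m) - w (Suc (i + r * m)))"
proof (induction m arbitrary: i)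
  case (Suc m)
  have "(\<Sum>j\<le>2 * Suc m + 1. (- 1) ^ j * of_nat ((2 * Suc m + 1) choose j) * w (i + j))
      = (\<Sum>j\<le>2 * m + 1. (- 1) ^ j * of_nat ((2 * m + 1) choose j)
          * (w (i + j) - w (i + Suc j) - (w (i + Suc j) - w (i + Suc (Suc j)))))"
    using alternating_binomial_sum_Suc[of "2 * m + 2" "\<lambda>j. w (i + j)"]
      alternating_binomial_sum_Suc[of "2 * m + 1" "\<lambda>j. w (i + j) - w (i + Suc j)"] by simp
  also have "\<dots> = (\<Sum>j\<le>2 * m + 1. c * ((- 1) ^ j * of_nat ((2 * m + 1) choose j) * w ((i + r) + j)))"
  proof (rule sum.cong)
    fix j
    have "w (i + j) - w (i + Suc j) - (w (i + Suc j) - w (i + Suc (Suc j))) = c * w ((i + r) + j)"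
      using assms[of "i + j"] by (simp add: algebra_simps)
    then show "(- 1) ^ j * of_nat ((2 * m + 1) choose j)
          * (w (i + j) - w (i + Suc j) - (w (i + Suc j) - w (i + Suc (Suc j))))
        = c * ((- 1) ^ j * of_nat ((2 * m + 1) choose j) * w ((i + r) + j))"
      by (simp only: mult.left_commute)
  qed simp
  also have "\<dots> = c * (c ^ m * (w ((i + r) + r * m) - w (Suc ((i + r) + r * m))))"
    unfolding sum_distrib_left[symmetric] Suc.IH ..
  finally show ?case
    by (simp add: add.assoc algebra_simps)
qed simp


section \<open>The character modulo 3 and the sequence u(2, 2)\<close>

lemma Legendre_3:
  "Legendre (int k) 3 = (if k mod 3 = 0 then 0 else if k mod 3 = 1 then 1 else - 1)"
proof -
  have "QuadRes 3 (int k)" if "k mod 3 = 1"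
    unfolding QuadRes_def using that by (intro exI[of _ 1]) (simp add: cong_def, presburger)
  moreover have "\<not> QuadRes 3 (int k)" if "k mod 3 = 2"
  proof
    assume "QuadRes 3 (int k)"
    then obtain y :: int where "y ^ 2 mod 3 = int k mod 3"
      by (auto simp: QuadRes_def cong_def)
    moreover have "y mod 3 = 0 \<or> y mod 3 = 1 \<or> y mod 3 = 2"
      by presburger
    then have "y ^ 2 mod 3 = 0 \<or> y ^ 2 mod 3 = 1"
      by (auto simp: power_mod[of y 3 2, symmetric])
    ultimately show False
      using that by presburger
  qed
  moreover have "[int k = 0] (mod 3) \<longleftrightarrow> k mod 3 = 0"
    unfolding cong_def by simp presburger
  moreover have "k mod 3 = 0 \<or> k mod 3 = 1 \<or> k mod 3 = 2"
    by presburger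
  ultimately show ?thesis
    by (auto simp: Legendre_def)
qed

lemma Legendre_3_rec:
  "Legendre (int (Suc (Suc k))) 3 = - Legendre (int k) 3 - Legendre (int (Suc k)) 3"
  unfolding Legendre_3 by (auto simp: mod_Suc)

lemma lucas_u_2_2_mod_4:
  "lucas_u 2 2 (4 * t) = 0 \<and> lucas_u 2 2 (Suc (4 * t)) = (- 4) ^ t"
  by (induction t) (auto simp: numeral_eq_Suc)

text \<open>
  Here \<open>u\<^sub>k\<close> is the imaginary part of \<open>(1 + i)\<^sup>k\<close> and \<open>u\<^bsub>k+1\<^esub> - u\<^sub>k\<close> its real part. Both are
  \<open>\<plusminus> 2\<^sup>m\<close> at odd \<open>k = 2m + 1\<close>, because \<open>(1 + i)\<^sup>2 = 2i\<close>.
\<close>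

lemma lucas_u_2_2_odd:
  obtains e :: int where "e ^ 2 = 1"
    "lucas_u 2 2 (Suc (2 * m + 1)) - lucas_u 2 2 (2 * m + 1) = e * 2 ^ m"
    "lucas_u 2 2 (2 * m + 1) = (- 1) ^ m * (e * 2 ^ m)"
proof (cases "even m")
  case True
  then obtain t where t: "m = 2 * t" ..
  have "(- 4) ^ t = (- 1) ^ t * (2::int) ^ m"
    unfolding t power_mult by (simp flip: power_mult_distrib)
  then show thesis
    using lucas_u_2_2_mod_4[of t] by (intro that[of "(- 1) ^ t"]) (simp_all add: t flip: power_mult)
next
  case False
  then obtain t where t: "m = 2 * t + 1" by (elim oddE)
  have "(- 4) ^ t * 2 = (- 1) ^ t * (2::int) ^ m"
    unfolding t power_add power_mult by (simp flip: power_mult_distrib)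
  moreover have "2 * m + 1 = Suc (Suc (Suc (4 * t)))"
    unfolding t by simp
  moreover have "(- 1) ^ m = (- 1 :: int)"
    using False by simp
  ultimately show thesis
    using lucas_u_2_2_mod_4[of t] by (intro that[of "- ((- 1) ^ t)"]) (simp_all flip: power_mult)
qed


section \<open>Congruences in the localization at a prime\<close>

text \<open>
  Fractions need not be in lowest terms here, so sums and products can be formed naively.
\<close>

lemma localized_ints_iff:
  assumes "prime p"
  shows "r \<in> localized_ints p \<longleftrightarrow> (\<exists>a b::int. coprime b (int p) \<and> r = of_int a / of_int b)"
proof
  assume "r \<in> localized_ints p"
  then show "\<exists>a b::int. coprime b (int p) \<and> r = of_int a / of_int b"
    unfolding localized_ints_def
    by (metis (mono_tags, lifting) mem_Collect_eq prod.collapse quotient_of_div)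
next
  assume "\<exists>a b::int. coprime b (int p) \<and> r = of_int a / of_int b"
  then obtain a b :: int where b: "coprime b (int p)" and r: "r = of_int a / of_int b"
    by blast
  have b0: "b \<noteq> 0"
    using b assms by (auto simp: prime_nat_iff)
  obtain n d where q: "quotient_of r = (n, d)"
    by fastforce
  have d: "d > 0" "coprime n d" "r = of_int n / of_int d"
    using quotient_of_denom_pos[OF q] quotient_of_coprime[OF q] quotient_of_div[OF q] by auto
  have "(of_int (n * b) :: rat) = of_int (a * d)"
    using r d b0 by (simp add: field_simps)
  then have "n * b = a * d"
    by (simp only: of_int_eq_iff)
  then have "d dvd n * b"
    by simp
  then have "d dvd b"
    using d(2) by (simp add: coprime_commute coprime_dvd_mult_right_iff)
  then have "coprime d (int p)"
    using b by (meson coprime_divisors dvd_refl)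
  then show "r \<in> localized_ints p"
    by (simp add: localized_ints_def q)
qed

context
  fixes p :: nat
  assumes prime_p: "prime p"
begin

lemma p_pos: "p > 0"
  using prime_p prime_gt_0_nat by blast

lemma localized_of_int [simp]: "of_int a \<in> localized_ints p"
  by (subst localized_ints_iff[OF prime_p], rule exI[of _ a], rule exI[of _ 1]) simp

lemma localized_of_nat [simp]: "of_nat a \<in> localized_ints p"
  using localized_of_int[of "int a"] by simp

lemma localized_0 [simp]: "0 \<in> localized_ints p"
  using localized_of_int[of 0] by simp

lemma localized_1 [simp]: "1 \<in> localized_ints p"
  using localized_of_int[of 1] by simp

lemma localized_mult [intro]:
  assumes "x \<in> localized_ints p" "y \<in> localized_ints p"
  shows "x * y \<in> localized_ints p"
proof -
  obtain a b c d where "coprime b (int p)" "x = of_int a / of_int b"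
    "coprime d (int p)" "y = of_int c / of_int d"
    using assms localized_ints_iff[OF prime_p] by meson
  then have "coprime (b * d) (int p) \<and> x * y = of_int (a * c) / of_int (b * d)"
    by simp
  then show ?thesis
    using localized_ints_iff[OF prime_p] by blast
qed

lemma localized_add [intro]:
  assumes "x \<in> localized_ints p" "y \<in> localized_ints p"
  shows "x + y \<in> localized_ints p"
proof -
  obtain a b c d where h: "coprime b (int p)" "x = of_int a / of_int b"
    "coprime d (int p)" "y = of_int c / of_int d"
    using assms localized_ints_iff[OF prime_p] by meson
  moreover have "b \<noteq> 0" "d \<noteq> 0"
    using h prime_p by (auto simp: prime_nat_iff)
  ultimately have "coprime (b * d) (int p) \<and> x + y = of_int (a * d + c * b) / of_int (b * d)"
    by (simp add: add_frac_eq)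
  then show ?thesis
    using localized_ints_iff[OF prime_p] by blast
qed

lemma localized_uminus [intro]: "x \<in> localized_ints p \<Longrightarrow> - x \<in> localized_ints p"
  using localized_mult[of "of_int (- 1)" x] localized_of_int[of "- 1"] by simp

lemma localized_diff [intro]:
  "x \<in> localized_ints p \<Longrightarrow> y \<in> localized_ints p \<Longrightarrow> x - y \<in> localized_ints p"
  using localized_add[of x "- y"] localized_uminus[of y] by simp

lemma localized_power [intro]: "x \<in> localized_ints p \<Longrightarrow> x ^ n \<in> localized_ints p"
  by (induction n) auto

lemma localized_sum [intro]:
  "(\<And>x. x \<in> S \<Longrightarrow> f x \<in> localized_ints p) \<Longrightarrow> sum f S \<in> localized_ints p"
  by (induction S rule: infinite_finite_induct) auto

lemma localized_divide_int:
  assumes "x \<in> localized_ints p" "\<not> int p dvd b"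
  shows "x / of_int b \<in> localized_ints p"
proof -
  have "coprime b (int p)"
    using assms(2) prime_p prime_imp_coprime[of "int p" b] by (simp add: coprime_commute)
  then have "1 / of_int b \<in> localized_ints p"
    by (subst localized_ints_iff[OF prime_p]) (metis of_int_1)
  from localized_mult[OF assms(1) this] show ?thesis
    by simp
qed

lemma localized_divide_nat:
  assumes "x \<in> localized_ints p" "0 < j" "j < p"
  shows "x / of_nat j \<in> localized_ints p"
  using localized_divide_int[of x "int j"] assms by (simp add: nat_dvd_not_less)

lemma rat_cong_iff: "[x \<equiv> y] (rmod p) \<longleftrightarrow> (x - y) / of_nat p \<in> localized_ints p"
proof -
  have "x - y = of_nat p * z \<longleftrightarrow> z = (x - y) / of_nat p" for z
    using p_pos by (auto simp: field_simps)
  then show ?thesis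
    unfolding rat_cong_def by auto
qed

lemma rat_cong_refl [simp]: "[x \<equiv> x] (rmod p)"
  by (simp add: rat_cong_iff)

lemma rat_cong_sym: "[x \<equiv> y] (rmod p) \<Longrightarrow> [y \<equiv> x] (rmod p)"
  unfolding rat_cong_iff by (metis localized_uminus minus_diff_eq minus_divide_left)

lemma rat_cong_add:
  "[x \<equiv> y] (rmod p) \<Longrightarrow> [z \<equiv> w] (rmod p) \<Longrightarrow> [x + z \<equiv> y + w] (rmod p)"
  using localized_add unfolding rat_cong_iff
  by (metis add_diff_add add_divide_distrib)

lemma rat_cong_trans [trans]:
  "[x \<equiv> y] (rmod p) \<Longrightarrow> [y \<equiv> z] (rmod p) \<Longrightarrow> [x \<equiv> z] (rmod p)"
  using rat_cong_add[of x y y z] by (simp add: rat_cong_iff)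

lemma rat_cong_mult_left:
  assumes "[x \<equiv> y] (rmod p)" "z \<in> localized_ints p"
  shows "[z * x \<equiv> z * y] (rmod p)"
  using localized_mult[OF assms(2) assms(1)[unfolded rat_cong_iff]]
  unfolding rat_cong_iff by (simp add: algebra_simps diff_divide_distrib)

lemma rat_cong_mult:
  assumes "[x \<equiv> y] (rmod p)" "[z \<equiv> w] (rmod p)" "x \<in> localized_ints p" "w \<in> localized_ints p"
  shows "[x * z \<equiv> y * w] (rmod p)"
  using rat_cong_trans[OF rat_cong_mult_left[OF assms(2,3)]]
    rat_cong_mult_left[OF assms(1,4)] by (simp add: mult.commute)

lemma rat_cong_uminus: "[x \<equiv> y] (rmod p) \<Longrightarrow> [- x \<equiv> - y] (rmod p)"
  using rat_cong_mult_left[of x y "- 1"] localized_uminus[OF localized_1] by simp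

lemma rat_cong_diff:
  "[x \<equiv> y] (rmod p) \<Longrightarrow> [z \<equiv> w] (rmod p) \<Longrightarrow> [x - z \<equiv> y - w] (rmod p)"
  using rat_cong_add[OF _ rat_cong_uminus] by fastforce

lemma rat_cong_power:
  assumes "[x \<equiv> y] (rmod p)" "x \<in> localized_ints p" "y \<in> localized_ints p"
  shows "[x ^ n \<equiv> y ^ n] (rmod p)"
  by (induction n) (use assms in \<open>auto intro!: rat_cong_mult\<close>)

lemma rat_cong_sum:
  "(\<And>x. x \<in> S \<Longrightarrow> [f x \<equiv> g x] (rmod p)) \<Longrightarrow> [sum f S \<equiv> sum g S] (rmod p)"
  by (induction S rule: infinite_finite_induct) (auto intro: rat_cong_add)

lemma rat_cong_of_int:
  assumes "[a = b] (mod int p)"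
  shows "[of_int a \<equiv> of_int b] (rmod p)"
proof -
  obtain c where "a - b = int p * c"
    using assms by (metis cong_iff_dvd_diff dvdE)
  then have "(of_int a :: rat) - of_int b = of_nat p * of_int c"
    by (metis of_int_diff of_int_mult of_int_of_nat_eq)
  then show ?thesis
    unfolding rat_cong_def using localized_of_int by blast
qed


section \<open>Harmonic numbers modulo a prime\<close>

lemma harmonic_0 [simp]: "harmonic 0 = 0"
  by (simp add: harmonic_def)

lemma harmonic_Suc: "harmonic (Suc n) = harmonic n + 1 / of_nat (Suc n)"
proof -
  have "{0<..Suc n} = insert (Suc n) {0<..n}" by auto
  then show ?thesis by (simp add: harmonic_def)
qed

lemma localized_harmonic:
  assumes "k < p"
  shows "harmonic k \<in> localized_ints p"
  unfolding harmonic_def using assms by (intro localized_sum localized_divide_nat) auto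

lemma inverse_reflect_cong:
  assumes "0 < j" "j < p"
  shows "[1 / of_nat (p - j) \<equiv> - (1 / of_nat j)] (rmod p)"
proof -
  have "1 / of_nat (p - j) / of_nat j \<in> localized_ints p"
    using assms by (intro localized_divide_nat) auto
  moreover have "(1 / of_nat (p - j) - - (1 / of_nat j)) / of_nat p
      = (1 / of_nat (p - j) / of_nat j :: rat)"
    using assms by (simp add: of_nat_diff field_simps)
  ultimately show ?thesis
    by (simp add: rat_cong_iff)
qed

lemma harmonic_prime_minus_1:
  assumes "p > 2"
  shows "[harmonic (p - 1) \<equiv> 0] (rmod p)"
proof -
  have set: "{0<..p - 1} = {1..p-1}" by auto
  have "harmonic (p - 1) = (\<Sum>j\<in>{1..p-1}. 1 / of_nat (p - j))"
    unfolding harmonic_def set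
    by (rule sum.reindex_bij_witness[of _ "\<lambda>j. p - j" "\<lambda>j. p - j"]) auto
  also have "[\<dots> \<equiv> (\<Sum>j\<in>{1..p-1}. - (1 / of_nat j))] (rmod p)"
    by (intro rat_cong_sum inverse_reflect_cong) auto
  also have "(\<Sum>j\<in>{1..p-1}. - (1 / of_nat j)) = - harmonic (p - 1)"
    unfolding harmonic_def set by (simp add: sum_negf)
  finally have "(2 * harmonic (p - 1)) / of_nat p \<in> localized_ints p"
    by (simp add: rat_cong_iff)
  from localized_divide_nat[OF this, of 2] have "2 * harmonic (p - 1) / of_nat p / of_nat 2 \<in> localized_ints p"
    using assms by simp
  then show ?thesis
    by (simp add: rat_cong_iff)
qed

lemma harmonic_reflect_cong:
  assumes "p > 2" "k < p"
  shows "[harmonic (p - 1 - k) \<equiv> harmonic k] (rmod p)"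
  using assms(2)
proof (induction k)
  case 0
  then show ?case using harmonic_prime_minus_1[OF assms(1)] by simp
next
  case (Suc k)
  have "p - 1 - k = Suc (p - 1 - Suc k)" "Suc (p - 1 - Suc k) = p - Suc k"
    using Suc.prems by auto
  then have "harmonic (p - 1 - Suc k) = harmonic (p - 1 - k) - 1 / of_nat (p - Suc k)"
    by (metis add_diff_cancel_right' harmonic_Suc)
  also have "[\<dots> \<equiv> harmonic k - - (1 / of_nat (Suc k))] (rmod p)"
    using Suc by (intro rat_cong_diff inverse_reflect_cong) auto
  finally show ?case
    by (simp add: harmonic_Suc)
qed

text \<open>
  Abel summation: passing to an antidifference \<open>f\<close> of the weights replaces the harmonic numbers by
  plain reciprocals.
\<close>

lemma harmonic_sum_by_parts:
  fixes f e :: "nat \<Rightarrow> rat"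
  assumes "\<And>k. f (Suc k) - f k = e k"
  shows "(\<Sum>k = 0..n. e k * harmonic k) = f (Suc n) * harmonic n - (\<Sum>j = 1..n. f j / of_nat j)"
proof (induction n)
  case (Suc n)
  have e: "e (Suc n) = f (Suc (Suc n)) - f (Suc n)"
    using assms by simp
  show ?case
    using Suc by (simp add: harmonic_Suc e algebra_simps diff_divide_distrib)
qed simp

lemma harmonic_sum_cong:
  fixes f e :: "nat \<Rightarrow> rat"
  assumes "p > 2" "\<And>k. f (Suc k) - f k = e k" "f p \<in> localized_ints p"
  shows "[(\<Sum>k = 0..p - 1. e k * harmonic k) \<equiv> - (\<Sum>j = 1..p - 1. f j / of_nat j)] (rmod p)"
proof -
  have "[f p * harmonic (p - 1) - (\<Sum>j = 1..p - 1. f j / of_nat j)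
      \<equiv> f p * 0 - (\<Sum>j = 1..p - 1. f j / of_nat j)] (rmod p)"
    using assms by (intro rat_cong_diff rat_cong_mult_left harmonic_prime_minus_1) auto
  then show ?thesis
    using harmonic_sum_by_parts[where f = f and e = e and n = "p - 1", OF assms(2)] p_pos by simp
qed


section \<open>Reflection of Lucas sequences\<close>

text \<open>
  In terms of the roots, \<open>(a b)\<^sup>k a\<^bsup>p-1-k\<^esup> = b\<^sup>k a\<^bsup>p-1\<^esup> \<equiv> b\<^sup>k\<close> by Fermat's little theorem: the reflection
  interchanges the two roots, under which \<open>u\<close> is antisymmetric and \<open>v\<close> symmetric.
\<close>

lemma lucas_reflect_cong:
  fixes A B :: int
  assumes "p > 2" "Legendre (A ^ 2 - 4 * B) (int p) = 1" "\<not> int p dvd B" "k < p"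
  shows "[B ^ k * lucas_u A B (p - 1 - k) = - lucas_u A B k] (mod int p)" (is ?u)
    and "[B ^ k * lucas_v A B (p - 1 - k) = lucas_v A B k] (mod int p)" (is ?v)
proof -
  obtain a b where ab: "[a + b = A] (mod int p)" "[a * b = B] (mod int p)" "\<not> int p dvd a - b"
    using char_roots_exist[OF prime_p assms(1,2)] by blast
  have not_dvd: "\<not> int p dvd a" "\<not> int p dvd b"
    using ab(2) assms(3) by (metis cong_dvd_iff dvd_mult dvd_mult2)+
  have fermat: "[c ^ (p - 1) = 1] (mod int p)" if "\<not> int p dvd c" for c
  proof -
    have c: "[int (nat (c mod int p)) = c] (mod int p)"
      using p_pos by (simp add: cong_def)
    then have "\<not> p dvd nat (c mod int p)"
      using that cong_dvd_iff int_dvd_int_iff by blast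
    then have "[nat (c mod int p) ^ (p - 1) = 1] (mod p)"
      using prime_p by (intro fermat_theorem)
    then have "[int (nat (c mod int p)) ^ (p - 1) = 1] (mod int p)"
      by (metis cong_int_iff of_nat_1 of_nat_power)
    then show ?thesis
      using c by (meson cong_pow cong_sym cong_trans)
  qed
  have turn: "[(a * b) ^ k * c ^ (p - 1 - k) = d ^ k] (mod int p)"
    if "c * d = a * b" "\<not> int p dvd c" for c d
  proof -
    have "(a * b) ^ k * c ^ (p - 1 - k) = d ^ k * c ^ (k + (p - 1 - k))"
      unfolding power_add that(1)[symmetric] by (simp add: power_mult_distrib algebra_simps)
    also have "\<dots> = d ^ k * c ^ (p - 1)"
      using assms(4) by simp
    also have "[\<dots> = d ^ k * 1] (mod int p)"
      by (intro cong_mult fermat that(2)) auto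
    finally show ?thesis by simp
  qed
  have turn_a: "[(a * b) ^ k * a ^ (p - 1 - k) = b ^ k] (mod int p)"
    using turn[of a b] not_dvd by simp
  have turn_b: "[(a * b) ^ k * b ^ (p - 1 - k) = a ^ k] (mod int p)"
    using turn[of b a] not_dvd by (simp add: mult.commute)
  have Bk: "[B ^ k = (a * b) ^ k] (mod int p)"
    using ab(2) by (intro cong_pow) (rule cong_sym)
  have "[B ^ k * ((a - b) * lucas_u A B (p - 1 - k))
      = (a * b) ^ k * (a ^ (p - 1 - k) - b ^ (p - 1 - k))] (mod int p)"
    by (intro cong_mult Bk lucas_u_roots_cong ab)
  also have "(a * b) ^ k * (a ^ (p - 1 - k) - b ^ (p - 1 - k))
      = (a * b) ^ k * a ^ (p - 1 - k) - (a * b) ^ k * b ^ (p - 1 - k)"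
    by (simp add: algebra_simps)
  also have "[\<dots> = b ^ k - a ^ k] (mod int p)"
    by (intro cong_diff turn_a turn_b)
  also have "b ^ k - a ^ k = - (a ^ k - b ^ k)"
    by simp
  also have "[\<dots> = - ((a - b) * lucas_u A B k)] (mod int p)"
    using cong_sym[OF lucas_u_roots_cong[OF ab(1,2), of k]] by (simp only: cong_minus_minus_iff)
  finally have "[(a - b) * (B ^ k * lucas_u A B (p - 1 - k)) = (a - b) * (- lucas_u A B k)] (mod int p)"
    by (simp add: algebra_simps)
  moreover have "coprime (a - b) (int p)"
    using ab(3) prime_p prime_imp_coprime[of "int p" "a - b"] by (simp add: coprime_commute)
  ultimately show ?u
    using cong_mult_lcancel by blast
  have "[B ^ k * lucas_v A B (p - 1 - k)
      = (a * b) ^ k * (a ^ (p - 1 - k) + b ^ (p - 1 - k))] (mod int p)"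
    by (intro cong_mult Bk lucas_v_roots_cong ab)
  also have "(a * b) ^ k * (a ^ (p - 1 - k) + b ^ (p - 1 - k))
      = (a * b) ^ k * a ^ (p - 1 - k) + (a * b) ^ k * b ^ (p - 1 - k)"
    by (simp add: algebra_simps)
  also have "[\<dots> = b ^ k + a ^ k] (mod int p)"
    by (intro cong_add turn_a turn_b)
  also have "[b ^ k + a ^ k = lucas_v A B k] (mod int p)"
    using lucas_v_roots_cong[OF ab(1,2), of k] by (simp add: cong_sym add.commute)
  finally show ?v .
qed

text \<open>
  The sign \<open>s\<close> covers both Lucas sequences: \<open>s = 1\<close> for \<open>u\<close> and \<open>s = - 1\<close> for \<open>v\<close>.
  Termwise, the second summand of the factor produces minus the first summand at \<open>p - 1 - k\<close>.
\<close>

lemma reflected_sum_cong: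
  fixes B s :: int and w :: "nat \<Rightarrow> int"
  assumes "p > 2" "\<not> int p dvd B"
    and reflect: "\<And>k. k < p \<Longrightarrow> [B ^ k * w (p - 1 - k) = - s * w k] (mod int p)"
  shows "[(\<Sum>k = 0..p - 1. (1 + of_int s * of_int B powi (- int k)) * of_int (w k) * harmonic k ^ n)
    \<equiv> 0] (rmod p)"
proof -
  have B0: "B \<noteq> 0"
    using assms(2) by auto
  have turned: "[of_int s * of_int B powi (- int k) * of_int (w k) * harmonic k ^ n
      \<equiv> - of_int (w (p - 1 - k)) * harmonic (p - 1 - k) ^ n] (rmod p)" if k: "k < p" for k
  proof (rule rat_cong_mult)
    have "\<not> int p dvd B ^ k"
      using assms(2) prime_p prime_dvd_power[of "int p" B k] by auto
    then have inv: "1 / of_int (B ^ k) \<in> localized_ints p"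
      by (rule localized_divide_int[OF localized_1])
    have powi: "(of_int B :: rat) powi (- int k) = 1 / of_int (B ^ k)"
      by (simp add: power_int_minus divide_inverse)
    have "[1 / of_int (B ^ k) * of_int (s * w k)
        \<equiv> 1 / of_int (B ^ k) * of_int (- (B ^ k * w (p - 1 - k)))] (rmod p)"
      using reflect[OF k] by (intro rat_cong_mult_left inv rat_cong_of_int)
        (metis cong_minus_minus_iff cong_sym minus_mult_left minus_minus)
    then show "[of_int s * of_int B powi (- int k) * of_int (w k) \<equiv> - of_int (w (p - 1 - k))] (rmod p)"
      using B0 by (simp add: powi field_simps)
    show "of_int s * of_int B powi (- int k) * of_int (w k) \<in> localized_ints p"
      unfolding powi by (intro localized_mult inv localized_of_int)
    show "[harmonic k ^ n \<equiv> harmonic (p - 1 - k) ^ n] (rmod p)"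
      using k assms(1)
      by (intro rat_cong_power rat_cong_sym[OF harmonic_reflect_cong] localized_harmonic) auto
    show "harmonic (p - 1 - k) ^ n \<in> localized_ints p"
      using k by (intro localized_power localized_harmonic) auto
  qed
  have "(\<Sum>k = 0..p - 1. (1 + of_int s * of_int B powi (- int k)) * of_int (w k) * harmonic k ^ n)
      = (\<Sum>k = 0..p - 1. of_int (w k) * harmonic k ^ n)
      + (\<Sum>k = 0..p - 1. of_int s * of_int B powi (- int k) * of_int (w k) * harmonic k ^ n)"
    by (simp add: algebra_simps sum.distrib)
  also have "[\<dots> \<equiv> (\<Sum>k = 0..p - 1. of_int (w k) * harmonic k ^ n)
      + (\<Sum>k = 0..p - 1. - of_int (w (p - 1 - k)) * harmonic (p - 1 - k) ^ n)] (rmod p)"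
    using p_pos by (intro rat_cong_add rat_cong_sum turned rat_cong_refl) auto
  also have "(\<Sum>k = 0..p - 1. - of_int (w (p - 1 - k)) * harmonic (p - 1 - k) ^ n)
      = (\<Sum>k = 0..p - 1. - of_int (w k) * harmonic k ^ n)"
    by (rule sum.reindex_bij_witness[of _ "\<lambda>k. p - 1 - k" "\<lambda>k. p - 1 - k"]) auto
  finally show ?thesis
    by (simp add: sum_negf)
qed


section \<open>Sums over reciprocals as finite differences\<close>

lemma binomial_prime_minus_1_cong:
  "j < p \<Longrightarrow> [int ((p - 1) choose j) = (- 1) ^ j] (mod int p)"
proof (induction j)
  case (Suc j)
  have "p choose Suc j = (p - 1 choose j) + (p - 1 choose Suc j)"
    using p_pos by (cases p) auto
  moreover have "[int (p choose Suc j) = 0] (mod int p)"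
    using Suc.prems prime_p by (simp add: cong_0_iff dvd_choose_prime)
  ultimately have "[int (p - 1 choose j) + int (p - 1 choose Suc j) - int (p - 1 choose j) = 0 - (- 1) ^ j] (mod int p)"
    using Suc by (intro cong_diff) auto
  then show ?case by simp
qed simp

text \<open>
  From \<open>j (p choose j) = p (p - 1 choose j - 1)\<close> and \<open>(p - 1 choose j - 1) \<equiv> (-1)\<^bsup>j-1\<^esup>\<close>.
\<close>

lemma inverse_cong_binomial:
  assumes "0 < j" "j < p"
  shows "[1 / of_nat j \<equiv> - ((- 1) ^ j * of_nat (p choose j) / of_nat p)] (rmod p)"
proof -
  obtain i where i: "j = Suc i"
    using assms by (cases j) auto
  have sq: "(- 1) ^ i * (- 1) ^ i = (1 :: int)"
    by (simp flip: power_mult_distrib)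
  have "[(- 1) ^ i * (- 1) ^ i = (- 1) ^ i * int (p - 1 choose i)] (mod int p)"
    using assms i by (intro cong_mult cong_refl cong_sym[OF binomial_prime_minus_1_cong]) auto
  then have "[of_int 1 \<equiv> of_int ((- 1) ^ i * int (p - 1 choose i))] (rmod p)"
    unfolding sq by (rule rat_cong_of_int)
  then have *: "[1 / of_nat j * of_int 1 \<equiv> 1 / of_nat j * of_int ((- 1) ^ i * int (p - 1 choose i))] (rmod p)"
    using assms by (intro rat_cong_mult_left localized_divide_nat) auto
  have "j * (p choose j) = p * (p - 1 choose i)"
    unfolding i using binomial_absorption[of i p] by simp
  then have "of_nat j * of_nat (p choose j) = (of_nat p * of_nat (p - 1 choose i) :: rat)"
    by (metis of_nat_mult)
  then have absorb: "1 / of_nat j * of_nat (p - 1 choose i) = (of_nat (p choose j) / of_nat p :: rat)"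
    using assms by (simp add: field_simps)
  have "1 / of_nat j * of_int ((- 1) ^ i * int (p - 1 choose i))
      = (- 1) ^ i * (1 / of_nat j * of_nat (p - 1 choose i) :: rat)"
    by simp
  also have "\<dots> = - ((- 1) ^ j * of_nat (p choose j) / of_nat p)"
    unfolding absorb by (simp add: i)
  finally have "1 / of_nat j * of_int ((- 1) ^ i * int (p - 1 choose i))
      = (- ((- 1) ^ j * of_nat (p choose j) / of_nat p) :: rat)" .
  with * show ?thesis
    by simp
qed

text \<open>
  The alternating binomial sum over all \<open>j \<le> p\<close> is known exactly, so its part with \<open>0 < j < p\<close> is the
  exact value minus the boundary terms. Every coefficient in that part is divisible by \<open>p\<close>, hence the
  second claim; for \<open>p \<equiv> 2\<close> modulo 3 it yields \<open>(-3)\<^bsup>(p-1)/2\<^esup> \<equiv> - 1\<close>, and for the sequence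
  \<open>u(2, 2)\<close> that the real part of \<open>(1 + i)\<^sup>p\<close> is 1 modulo \<open>p\<close>.
\<close>

lemma reciprocal_sum_cong:
  fixes w :: "nat \<Rightarrow> rat" and c :: rat
  assumes "p = 2 * m + 1"
    and local_w: "\<And>j. w j \<in> localized_ints p"
    and rec: "\<And>i. w i - 2 * w (Suc i) + w (Suc (Suc i)) = c * w (i + r)"
  shows "[(\<Sum>j = 1..p - 1. w j / of_nat j)
      \<equiv> - ((c ^ m * (w (r * m) - w (Suc (r * m))) - w 0 + w p) / of_nat p)] (rmod p)" (is ?cong)
    and "(c ^ m * (w (r * m) - w (Suc (r * m))) - w 0 + w p) / of_nat p \<in> localized_ints p" (is "?X \<in> _")
proof -
  have split: "{..p} = insert 0 (insert p {1..p - 1})"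
    using p_pos by auto
  have "(\<Sum>j\<le>p. (- 1) ^ j * of_nat (p choose j) * w j)
      = w 0 - w p + (\<Sum>j = 1..p - 1. (- 1) ^ j * of_nat (p choose j) * w j)"
    unfolding split using assms(1) p_pos by (subst sum.insert; simp)+
  moreover have "(\<Sum>j\<le>p. (- 1) ^ j * of_nat (p choose j) * w j) = c ^ m * (w (r * m) - w (Suc (r * m)))"
    using alternating_binomial_sum[OF rec, of m 0] assms(1) by simp
  ultimately have X: "?X = (\<Sum>j = 1..p - 1. (- 1) ^ j * of_nat (p choose j) * w j) / of_nat p"
    by (simp add: algebra_simps)
  have "[(\<Sum>j = 1..p - 1. w j * (1 / of_nat j))
      \<equiv> (\<Sum>j = 1..p - 1. w j * - ((- 1) ^ j * of_nat (p choose j) / of_nat p))] (rmod p)"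
    by (intro rat_cong_sum rat_cong_mult_left local_w inverse_cong_binomial) auto
  also have "(\<Sum>j = 1..p - 1. w j * - ((- 1) ^ j * of_nat (p choose j) / of_nat p)) = - ?X"
    unfolding X by (simp add: sum_negf sum_divide_distrib mult.commute)
  finally show ?cong
    by simp
  have "(- 1) ^ j * of_nat (p choose j) * w j / of_nat p \<in> localized_ints p" if "j \<in> {1..p - 1}" for j
  proof -
    have "p dvd p choose j"
      using that prime_p by (intro dvd_choose_prime) auto
    then obtain d where "p choose j = p * d" ..
    then have "(- 1) ^ j * of_nat (p choose j) * w j / of_nat p = of_int ((- 1) ^ j * int d) * w j"
      using p_pos by simp
    then show ?thesis
      using local_w localized_of_int by (metis localized_mult)
  qed
  then show "?X \<in> localized_ints p"
    unfolding X sum_divide_distrib by (intro localized_sum)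
qed

lemma harmonic_weighted_sum_cong:
  fixes f e :: "nat \<Rightarrow> rat" and c :: rat
  assumes p: "p = 2 * m + 1"
    and diff: "\<And>k. f (Suc k) - f k = e k"
    and local_f: "\<And>j. f j \<in> localized_ints p"
    and rec: "\<And>i. f i - 2 * f (Suc i) + f (Suc (Suc i)) = c * f (i + r)"
  shows "[(\<Sum>k = 0..p - 1. e k * harmonic k)
      \<equiv> (c ^ m * (f (r * m) - f (Suc (r * m))) - f 0 + f p) / of_nat p] (rmod p)"
proof -
  have "p > 2"
    using p prime_ge_2_nat[OF prime_p] by simp
  then have "[(\<Sum>k = 0..p - 1. e k * harmonic k) \<equiv> - (\<Sum>j = 1..p - 1. f j / of_nat j)] (rmod p)"
    by (intro harmonic_sum_cong diff local_f)
  also have "[- (\<Sum>j = 1..p - 1. f j / of_nat j)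
      \<equiv> - (- ((c ^ m * (f (r * m) - f (Suc (r * m))) - f 0 + f p) / of_nat p))] (rmod p)"
    by (intro rat_cong_uminus reciprocal_sum_cong[OF p local_f rec])
  finally show ?thesis
    by simp
qed


section \<open>The four weighted sums of harmonic numbers\<close>

lemma prime_mod_3:
  assumes "p > 3" "p = 2 * m + 1"
  shows "p mod 3 = 1 \<and> m mod 3 = 0 \<or> p mod 3 = 2 \<and> m mod 3 = 2"
proof -
  have "\<not> 3 dvd p"
    using assms(1) prime_p by (metis prime_nat_iff nat_neq_iff numeral_eq_one_iff semiring_norm(84))
  then show ?thesis
    using assms(2) by presburger
qed

text \<open>
  If \<open>x\<close> is a primitive cube root of unity, then \<open>(1 - x)\<^sup>2 = - 3 x\<close>. For \<open>p \<equiv> 1\<close> modulo 3 the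
  boundary terms cancel. For \<open>p \<equiv> 2\<close> the sum is \<open>s = ((-3)\<^sup>m + 1)/p\<close> with \<open>m = (p - 1)/2\<close>, and
  squaring \<open>(-3)\<^sup>m = p s - 1\<close> shows that the Fermat quotient is \<open>- 2 s\<close> modulo \<open>p\<close>.
\<close>

lemma character_sum_cong:
  assumes "p > 3"
  shows "[(\<Sum>k = 0..p - 1. of_int (Legendre (int k) 3) * harmonic k) \<equiv>
        (of_int (Legendre (int p) 3) - 1) / 4 * fermat_quotient p 3] (rmod p)"
proof -
  define h :: "nat \<Rightarrow> rat" where "h k = of_int (Legendre (int k) 3)" for k
  \<comment> \<open>The antidifference of \<open>h\<close> that satisfies the same recurrence, i.e. without a constant term.\<close>
  define f where "f k = (h (Suc (Suc k)) - h k) / 3" for k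
  define q where "q = fermat_quotient p 3"
  obtain m where m: "p = 2 * m + 1"
    using prime_odd_nat[OF prime_p] assms by (auto elim: oddE)
  have h2: "h (Suc (Suc k)) = - h k - h (Suc k)" for k
    unfolding h_def using Legendre_3_rec[of k] by simp
  have h_mod: "h k = (if k mod 3 = 0 then 0 else if k mod 3 = 1 then 1 else - 1)" for k
    unfolding h_def Legendre_3 by simp
  have h_local: "h k \<in> localized_ints p" for k
    unfolding h_def by simp
  have f_local: "f k \<in> localized_ints p" for k
    unfolding f_def using assms localized_divide_nat[of _ 3] h_local by (simp add: localized_diff)
  have diff: "f (Suc k) - f k = h k" for k
    unfolding f_def h2 by (simp add: field_simps)
  have rec: "f i - 2 * f (Suc i) + f (Suc (Suc i)) = (- 3) * f (i + 1)" for i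
    unfolding f_def h2 Suc_eq_plus1[symmetric] by (simp add: field_simps)
  have S: "[(\<Sum>k = 0..p - 1. h k * harmonic k)
      \<equiv> ((- 3) ^ m * (f (1 * m) - f (Suc (1 * m))) - f 0 + f p) / of_nat p] (rmod p)"
    by (rule harmonic_weighted_sum_cong[OF m diff f_local rec])
  have X: "((- 3) ^ m * (f (1 * m) - f (Suc (1 * m))) - f 0 + f p) / of_nat p \<in> localized_ints p"
    by (rule reciprocal_sum_cong(2)[OF m f_local rec])
  have fm: "f (1 * m) - f (Suc (1 * m)) = - h m"
    using diff[of m] by simp
  from prime_mod_3[OF assms m] show ?thesis
  proof
    assume mod: "p mod 3 = 1 \<and> m mod 3 = 0"
    have "h m = 0" "f p = f 0" "Legendre (int p) 3 = 1"
      using mod by (auto simp: h_mod f_def mod_Suc Legendre_3)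
    then show ?thesis
      using S unfolding fm by (simp flip: h_def)
  next
    assume mod: "p mod 3 = 2 \<and> m mod 3 = 2"
    have v: "h m = - 1" "f p = 2 / 3" "f 0 = - 1 / 3" "Legendre (int p) 3 = - 1"
      using mod by (auto simp: h_mod f_def mod_Suc Legendre_3)
    define s where "s = ((- 3) ^ m + 1) / (of_nat p :: rat)"
    have s: "((- 3) ^ m * (f (1 * m) - f (Suc (1 * m))) - f 0 + f p) / of_nat p = s"
      unfolding fm v s_def by simp
    have s': "of_nat p * s - 1 = (- 3) ^ m"
      using p_pos by (simp add: s_def)
    have "(3::rat) ^ (p - 1) = ((- 3) ^ 2) ^ m"
      by (simp add: m power_mult)
    also have "\<dots> = (of_nat p * s - 1) ^ 2"
      unfolding s' by (simp only: power_mult[symmetric] mult.commute)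
    finally have "(3::rat) ^ (p - 1) = (of_nat p * s - 1) ^ 2" .
    then have "s - (- 1 - 1) / 4 * q = of_nat p * (s ^ 2 / of_nat 2)"
      using p_pos by (simp add: q_def fermat_quotient_def field_simps power2_eq_square)
    moreover have "s ^ 2 / of_nat 2 \<in> localized_ints p"
      using X s assms by (intro localized_divide_nat localized_power) auto
    ultimately have "[s \<equiv> (- 1 - 1) / 4 * q] (rmod p)"
      unfolding rat_cong_def by blast
    with S show ?thesis
      unfolding s v(4) q_def h_def by (auto intro: rat_cong_trans)
  qed
qed

text \<open>
  The weights \<open>a\<close> satisfy the recurrence of a primitive sixth root of unity \<open>x\<close>. As \<open>1 - x\<close> is the
  inverse of \<open>x\<close> and \<open>p \<equiv> \<plusminus>1\<close> modulo 6, the numerator \<open>(1 - x)\<^sup>p - 1 + x\<^sup>p\<close> vanishes, which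
  is the first congruence. For the weights \<open>k a\<^sub>k\<close> the antidifference has a term linear in \<open>k\<close>;
  divided by \<open>k\<close>, it contributes a telescoping sum, and the rest vanishes as before.
\<close>

lemma alternating_character_sums_cong:
  assumes "p > 3"
  shows "[(\<Sum>k = 0..p - 1. (- 1) ^ k * of_int (Legendre (int k) 3) * harmonic k) \<equiv> 0] (rmod p)"
    and "[(\<Sum>k = 0..p - 1. (- 1) ^ k * of_int (Legendre (int k) 3) * of_nat k * harmonic k) \<equiv>
        (1 - of_int (Legendre (int p) 3)) / 2] (rmod p)"
proof -
  define a :: "nat \<Rightarrow> rat" where "a k = (- 1) ^ k * of_int (Legendre (int k) 3)" for k
  obtain m where m: "p = 2 * m + 1"
    using prime_odd_nat[OF prime_p] assms by (auto elim: oddE)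
  have p2: "p > 2"
    using assms by simp
  have a2: "a (Suc (Suc k)) = a (Suc k) - a k" for k
    unfolding a_def Legendre_3_rec by (simp add: algebra_simps)
  have a_mod: "a k = (- 1) ^ k * (if k mod 3 = 0 then 0 else if k mod 3 = 1 then 1 else - 1)" for k
    unfolding a_def Legendre_3 by simp
  have a_local: "a k \<in> localized_ints p" for k
    using localized_of_int[of "(- 1) ^ k * Legendre (int k) 3"] by (simp add: a_def)
  have am: "(- 1) ^ m * a (m + j) = (- 1) ^ j * of_int (Legendre (int (m + j)) 3)" for j
    unfolding a_def power_add by (simp flip: power_mult_distrib)
  have ap: "a (p + j) = - ((- 1) ^ j * of_int (Legendre (int (p + j)) 3))" for j
    unfolding a_def m power_add by (simp add: power_mult)
  define f where "f k = - a (Suc k)" for k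
  have "[(\<Sum>k = 0..p - 1. a k * harmonic k)
      \<equiv> ((- 1) ^ m * (f (1 * m) - f (Suc (1 * m))) - f 0 + f p) / of_nat p] (rmod p)"
    by (rule harmonic_weighted_sum_cong[OF m])
      (simp_all add: f_def a2 localized_uminus a_local)
  moreover have "(- 1) ^ m * (f (1 * m) - f (Suc (1 * m))) - f 0 + f p = 0"
  proof -
    have "(- 1) ^ m * (f (1 * m) - f (Suc (1 * m))) - f 0 + f p
        = - ((- 1) ^ m * a (m + 0)) + a 1 - a (p + 1)"
      by (simp add: f_def a2)
    also have "\<dots> = 0"
      unfolding am ap Legendre_3 using prime_mod_3[OF assms m]
      by (auto simp: a_mod mod_Suc)
    finally show ?thesis .
  qed
  ultimately show "[(\<Sum>k = 0..p - 1. (- 1) ^ k * of_int (Legendre (int k) 3) * harmonic k) \<equiv> 0] (rmod p)"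
    by (simp add: a_def)
  have tail: "[(\<Sum>j = 1..p - 1. a j / of_nat j)
      \<equiv> - (((- 1) ^ m * (a (1 * m) - a (Suc (1 * m))) - a 0 + a p) / of_nat p)] (rmod p)"
    by (rule reciprocal_sum_cong[OF m a_local]) (simp add: a2)
  have tail_0: "(- 1) ^ m * (a (1 * m) - a (Suc (1 * m))) - a 0 + a p = 0"
  proof -
    have "a (1 * m) - a (Suc (1 * m)) = - a (m + 2)"
      by (simp add: a2)
    then have "(- 1) ^ m * (a (1 * m) - a (Suc (1 * m))) - a 0 + a p
        = - ((- 1) ^ m * a (m + 2)) - a 0 + a (p + 0)"
      by simp
    also have "\<dots> = 0"
      unfolding am ap Legendre_3 using prime_mod_3[OF assms m]
      by (auto simp: a_mod mod_Suc)
    finally show ?thesis .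
  qed
  have "a 0 = 0"
    by (simp add: a_mod)
  then have telescope: "(\<Sum>j = 1..n. a (Suc j)) = a n" for n
    by (induction n) (simp_all add: a2)
  define g where "g k = a k - of_nat k * a (Suc k)" for k
  have "[(\<Sum>k = 0..p - 1. (a k * of_nat k) * harmonic k) \<equiv> - (\<Sum>j = 1..p - 1. g j / of_nat j)] (rmod p)"
  proof (rule harmonic_sum_cong[OF p2])
    show "g (Suc k) - g k = a k * of_nat k" for k
      by (simp add: g_def a2 algebra_simps)
    show "g p \<in> localized_ints p"
      by (simp add: g_def localized_diff localized_mult a_local)
  qed
  also have "- (\<Sum>j = 1..p - 1. g j / of_nat j) = a (p - 1) - (\<Sum>j = 1..p - 1. a j / of_nat j)"
    using telescope[of "p - 1"] by (simp add: g_def diff_divide_distrib sum_subtractf)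
  also have "[a (p - 1) - (\<Sum>j = 1..p - 1. a j / of_nat j) \<equiv> a (p - 1) - - (0 / of_nat p)] (rmod p)"
    by (intro rat_cong_diff rat_cong_refl tail[unfolded tail_0])
  also have "a (p - 1) - - (0 / of_nat p) = (1 - of_int (Legendre (int p) 3)) / 2"
  proof -
    have "(- 1) ^ (p - 1) = (1 :: rat)"
      by (simp add: m)
    then have last: "a (p - 1) = (if (p - 1) mod 3 = 0 then 0 else if (p - 1) mod 3 = 1 then 1 else - 1)"
      unfolding a_mod by simp
    obtain q where q: "p = Suc q"
      using p_pos by (cases p) auto
    from prime_mod_3[OF assms m] have "q mod 3 = 0 \<and> p mod 3 = 1 \<or> q mod 3 = 1 \<and> p mod 3 = 2"
      unfolding q by (auto simp: mod_Suc split: if_splits)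
    then show ?thesis
      unfolding last Legendre_3 by (elim disjE) (simp_all add: q)
  qed
  finally show "[(\<Sum>k = 0..p - 1. (- 1) ^ k * of_int (Legendre (int k) 3) * of_nat k * harmonic k) \<equiv>
        (1 - of_int (Legendre (int p) 3)) / 2] (rmod p)"
    by (simp add: a_def)
qed

text \<open>
  For \<open>x = 1 + i\<close> and \<open>y = (1 + i)/2\<close> the relations are \<open>(1 - x)\<^sup>2 = - 1\<close> and \<open>(1 - y)\<^sup>2 = - y\<^sup>2\<close>.
  With \<open>R\<close> the real part of \<open>(1 + i)\<^sup>p\<close>, the two halves of the sum are \<open>(1 - R)/p\<close> and \<open>(1 - 1/R)/p\<close>.
  They add up to \<open>- (1 - R)\<^sup>2 / (p R)\<close>, which is divisible by \<open>p\<close> because \<open>R \<equiv> 1\<close>.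
\<close>

lemma lucas_2_2_sum_cong:
  assumes "p > 2"
  shows "[(\<Sum>k = 0..p - 1. (1 + 2 powi (- int k)) * of_int (lucas_u 2 2 k) * harmonic k) \<equiv> 0] (rmod p)"
proof -
  define u :: "nat \<Rightarrow> rat" where "u k = of_int (lucas_u 2 2 k)" for k
  \<comment> \<open>Antidifferences of the weights \<open>u k\<close> and \<open>u k / 2 ^ k\<close> that satisfy the same recurrences.\<close>
  define f where "f k = u k - u (Suc k)" for k
  define g where "g k = - (u (Suc k) / 2 ^ k)" for k
  obtain m where m: "p = 2 * m + 1"
    using prime_odd_nat[OF prime_p] assms by (auto elim: oddE)
  have odd: "\<not> int p dvd 2 ^ k" for k
    using prime_p assms by (metis dvd_imp_le int_dvd_int_iff not_le of_nat_numeral of_nat_power prime_dvd_power zero_less_numeral)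
  have u2: "u (Suc (Suc k)) = 2 * u (Suc k) - 2 * u k" for k
    by (simp add: u_def)
  have f_local: "f k \<in> localized_ints p" for k
    unfolding f_def u_def by (simp add: localized_diff)
  have g_local: "g k \<in> localized_ints p" for k
    unfolding g_def u_def using localized_divide_int[OF localized_of_int odd, of _ k]
    by (simp add: localized_uminus)
  obtain e :: int where e: "e ^ 2 = 1"
    "lucas_u 2 2 (Suc p) - lucas_u 2 2 p = e * 2 ^ m"
    "lucas_u 2 2 p = (- 1) ^ m * (e * 2 ^ m)"
    using lucas_u_2_2_odd[of m] unfolding m by auto
  define R :: rat where "R = of_int (e * 2 ^ m)"
  have R: "u (Suc p) - u p = R" "u p = (- 1) ^ m * R"
    unfolding u_def R_def using e by (metis of_int_diff, simp)
  have R2: "R * R = 2 ^ (2 * m)"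
  proof -
    have "R * R = (of_int (e ^ 2)) * ((2 ^ m) * (2 ^ m))"
      by (simp add: R_def power2_eq_square)
    then show ?thesis
      unfolding e(1) by (simp add: mult_2 power_add)
  qed
  have R0: "R \<noteq> 0"
    using R2 by auto
  have rec_f: "f i - 2 * f (Suc i) + f (Suc (Suc i)) = (- 1) * f (i + 0)" for i
    by (simp add: f_def u2 algebra_simps)
  have Xf: "(- 1) ^ m * (f (0 * m) - f (Suc (0 * m))) - f 0 + f p = 1 - R"
    using R by (simp add: f_def u_def)
  have sum_f: "[(\<Sum>k = 0..p - 1. u k * harmonic k) \<equiv> (1 - R) / of_nat p] (rmod p)"
    using harmonic_weighted_sum_cong[OF m _ f_local rec_f, of u] unfolding Xf
    by (simp add: f_def u2)
  have int_R: "(1 - R) / of_nat p \<in> localized_ints p"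
    using reciprocal_sum_cong(2)[OF m f_local rec_f] unfolding Xf .
  have rec_g: "g i - 2 * g (Suc i) + g (Suc (Suc i)) = (- 1) * g (i + 2)" for i
    by (simp add: g_def u2 field_simps)
  have Xg: "(- 1) ^ m * (g (2 * m) - g (Suc (2 * m))) - g 0 + g p = 1 - 1 / R"
  proof -
    have R': "1 / R = R / 2 ^ (2 * m)"
      unfolding R2[symmetric] using R0 by simp
    have s: "(- 1) ^ m * (- 1) ^ m = (1 :: rat)"
      by (simp flip: power_mult_distrib)
    have "(- 1) ^ m * (g (2 * m) - g (Suc (2 * m))) + g p
      = ((- 1) ^ m * (u (Suc p) - 2 * u p) - u (Suc p)) / 2 ^ p"
      by (simp add: g_def m field_simps)
    also have "u (Suc p) = R + (- 1) ^ m * R"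
      using R by simp
    also have "(- 1) ^ m * (R + (- 1) ^ m * R - 2 * u p) - (R + (- 1) ^ m * R)
        = - R - ((- 1) ^ m * (- 1) ^ m) * R"
      unfolding R(2) by (simp add: algebra_simps)
    finally have "(- 1) ^ m * (g (2 * m) - g (Suc (2 * m))) + g p = - (R / 2 ^ (2 * m))"
      unfolding s m by simp
    then show ?thesis
      unfolding R' by (simp add: g_def u_def)
  qed
  have sum_g: "[(\<Sum>k = 0..p - 1. u k / 2 ^ k * harmonic k) \<equiv> (1 - 1 / R) / of_nat p] (rmod p)"
    using harmonic_weighted_sum_cong[OF m _ g_local rec_g, of "\<lambda>k. u k / 2 ^ k"] unfolding Xg
    by (simp add: g_def u2 field_simps)
  have "(2::rat) powi (- int k) = 1 / 2 ^ k" for k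
    by (simp add: power_int_minus divide_inverse)
  then have "(\<Sum>k = 0..p - 1. (1 + 2 powi (- int k)) * of_int (lucas_u 2 2 k) * harmonic k)
      = (\<Sum>k = 0..p - 1. u k * harmonic k) + (\<Sum>k = 0..p - 1. u k / 2 ^ k * harmonic k)"
    by (simp add: u_def algebra_simps flip: sum.distrib)
  also have "[\<dots> \<equiv> (1 - R) / of_nat p + (1 - 1 / R) / of_nat p] (rmod p)"
    by (intro rat_cong_add sum_f sum_g)
  also have "[(1 - R) / of_nat p + (1 - 1 / R) / of_nat p \<equiv> 0] (rmod p)"
  proof -
    have "\<not> int p dvd e * 2 ^ m"
    proof
      assume "int p dvd e * 2 ^ m"
      then have "int p dvd e ^ 2 * 2 ^ m"
        unfolding power2_eq_square mult.assoc by (rule dvd_mult)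
      then show False
        using e(1) odd by simp
    qed
    then have "((1 - R) / of_nat p) ^ 2 / R \<in> localized_ints p"
      unfolding R_def[symmetric] by (metis R_def localized_divide_int localized_power int_R)
    then have "- (((1 - R) / of_nat p) ^ 2 / R) \<in> localized_ints p"
      by (rule localized_uminus)
    moreover have "((1 - R) / of_nat p + (1 - 1 / R) / of_nat p - 0) / of_nat p = - (((1 - R) / of_nat p) ^ 2 / R)"
      using R0 p_pos by (simp add: field_simps power2_eq_square)
    ultimately show ?thesis
      unfolding rat_cong_iff by simp
  qed
  finally show ?thesis .
qed

end

theorem theorem1p2:
  fixes p :: nat
  assumes "prime p" and "p > 3"
  shows
    "(\<forall>(A::int) (B::int) (n::nat).
        \<not> int p dvd B \<longrightarrow> Legendre (A ^ 2 - 4 * B) (int p) = 1 \<longrightarrow>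
          [(\<Sum>k = 0..p - 1. (1 + of_int B powi (- int k)) * of_int (lucas_u A B k)
              * harmonic k ^ n) \<equiv> 0] (rmod p) \<and>
          [(\<Sum>k = 0..p - 1. (1 - of_int B powi (- int k)) * of_int (lucas_v A B k)
              * harmonic k ^ n) \<equiv> 0] (rmod p)) \<and>
     [(\<Sum>k = 0..p - 1. (- 1) ^ k * of_int (Legendre (int k) 3) * harmonic k) \<equiv> 0] (rmod p) \<and>
     [(\<Sum>k = 0..p - 1. of_int (Legendre (int k) 3) * harmonic k) \<equiv>
        (of_int (Legendre (int p) 3) - 1) / 4 * fermat_quotient p 3] (rmod p) \<and>
     [(\<Sum>k = 0..p - 1. (- 1) ^ k * of_int (Legendre (int k) 3) * of_nat k * harmonic k) \<equiv>
        (1 - of_int (Legendre (int p) 3)) / 2] (rmod p) \<and>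
     [(\<Sum>k = 0..p - 1. (1 + 2 powi (- int k)) * of_int (lucas_u 2 2 k) * harmonic k) \<equiv> 0] (rmod p)"
proof -
  have p2: "p > 2"
    using assms(2) by simp
  show ?thesis
  proof (intro conjI allI impI)
    fix A B :: int and n :: nat
    assume B: "\<not> int p dvd B" and QR: "Legendre (A ^ 2 - 4 * B) (int p) = 1"
    show "[(\<Sum>k = 0..p - 1. (1 + of_int B powi (- int k)) * of_int (lucas_u A B k)
              * harmonic k ^ n) \<equiv> 0] (rmod p)"
      using reflected_sum_cong[OF assms(1) p2 B, of "lucas_u A B" 1 n]
        lucas_reflect_cong(1)[OF assms(1) p2 QR B] by simp
    show "[(\<Sum>k = 0..p - 1. (1 - of_int B powi (- int k)) * of_int (lucas_v A B k)
              * harmonic k ^ n) \<equiv> 0] (rmod p)"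
      using reflected_sum_cong[OF assms(1) p2 B, of "lucas_v A B" "- 1" n]
        lucas_reflect_cong(2)[OF assms(1) p2 QR B] by simp
  qed (intro alternating_character_sums_cong character_sum_cong lucas_2_2_sum_cong assms p2)+
qed

end
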